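(* Let $\lozenge$ be a binary operation on $\mathbf{M}$ such that $\lozenge(\mathbf{L}^2)\subset\mathbf{L}$, i.e., $\lozenge$ is closed on $\mathbf{L}$, and let $\lozenge^{\complement}$ be its dual operation. Then $\lozenge|_{\mathbf{L}^2}$ is a $t_r$-norm (resp., $t$-norm) on $\mathbf{L}$ if and only if $\lozenge^{\complement}|_{\mathbf{L}^2}$ is a $t_r$-conorm (resp., $t$-conorm) on $\mathbf{L}$.
   Context: Let $I=[0,1]$, let $\mathbf{M}$ be the set of all functions $f:I\to I$, and let $\wedge$ be min on $I$. A function $f\in\mathbf{M}$ is normal if $\sup_{x\in I}f(x)=1$, and convex if $f(y)\ge f(x)\wedge f(z)$ whenever $0\le x\le y\le z\le 1$. $\mathbf{L}$ is the set of all normal and convex $f\in\mathbf{M}$. For $B\subseteq I$, $\mathbf{1}_B$ is the characteristic function of $B$. $\mathbf{J}=\{\mathbf{1}_{\{x\}}\mid x\in I\}$ and $\mathbf{K}=\{\mathbf{1}_{[a,b]}\mid 0\le a\le b\le 1\}$. For $f\in\mathbf{M}$, $(\neg f)(x)=f(1-x)$. Dual operation: for a binary operation $\lozenge:\mathbf{M}^2\to\mathbf{M}$, $f\lozenge^{\complement}g=\neg((\neg f)\lozenge(\neg g))$ for $f,g\in\mathbf{M}$. Order: for $f,g\in\mathbf{M}$ let $(f\sqcap g)(x)=\sup\{f(y)\wedge g(z)\mid y\wedge z=x\}$, and write $f\sqsubseteq g$ if $f\sqcap g=f$. Axioms for a binary operation $T:\mathbf{L}^2\to\mathbf{L}$: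 (O1) $T(f,g)=T(g,f)$ for $f,g\in\mathbf{L}$; (O2) $T(T(f,g),h)=T(f,T(g,h))$ for $f,g,h\in\mathbf{L}$; (O3) $T(f,\mathbf{1}_{\{1\}})=f$ for $f\in\mathbf{L}$; (O3') $T(f,\mathbf{1}_{\{0\}})=f$ for $f\in\mathbf{L}$; (O4) for $f,g,h\in\mathbf{L}$ with $f\sqsubseteq g$, $T(f,h)\sqsubseteq T(g,h)$; (O5) $T(\mathbf{1}_{[0,1]},\mathbf{1}_{[a,b]})=\mathbf{1}_{[0,b]}$ for $0\le a\le b\le1$; (O5') $T(\mathbf{1}_{[0,1]},\mathbf{1}_{[a,b]})=\mathbf{1}_{[a,1]}$ for $0\le a\le b\le1$; (O6) $T(\mathbf{J}^2)\subseteq\mathbf{J}$; (O7) $T(\mathbf{K}^2)\subseteq\mathbf{K}$. $T$ is a $t_r$-norm on $\mathbf{L}$ if it satisfies (O1), (O2), (O3), (O4), (O5), (O6), (O7); a $t_r$-conorm on $\mathbf{L}$ if it satisfies (O1), (O2), (O3'), (O4), (O5'), (O6), (O7); a $t$-norm on $\mathbf{L}$ if it satisfies (O1), (O2), (O3), (O4); a $t$-conorm on $\mathbf{L}$ if it satisfies (O1), (O2), (O3'), (O4). *)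

theory Defs
  imports Complex_Main "HOL-Library.FuncSet" "HOL-Library.Indicator_Function"
begin

text \<open>
  Functions on the unit interval are represented extensionally (they take the value
  \<open>undefined\<close> outside \<open>[0,1]\<close>), so that HOL equality on \<open>MM\<close> is
  equality of functions \<open>[0,1] \<rightarrow> [0,1]\<close>. Binary operations are uncurried;
  the restriction of an operation to a set of pairs is \<open>restrict\<close>.
\<close>

definition II :: "real set" where
  "II = {0..1}"

type_synonym ffun = "real \<Rightarrow> real"

definition MM :: "ffun set" where
  "MM = II \<rightarrow>\<^sub>E II"

definition is_normal :: "ffun \<Rightarrow> bool" where
  "is_normal f \<longleftrightarrow> (SUP x\<in>II. f x) = 1"

definition is_convex :: "ffun \<Rightarrow> bool" where
  "is_convex f \<longleftrightarrow> (\<forall>x y z. 0 \<le> x \<and> x \<le> y \<and> y \<le> z \<and> z \<le> 1 \<longrightarrow> f y \<ge> min (f x) (f z))"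

definition LL :: "ffun set" where
  "LL = {f \<in> MM. is_normal f \<and> is_convex f}"

definition chi :: "real set \<Rightarrow> ffun" where
  "chi B = restrict (indicator B) II"

definition JJ :: "ffun set" where
  "JJ = {chi {x} | x. x \<in> II}"

definition KK :: "ffun set" where
  "KK = {chi {a..b} | a b. 0 \<le> a \<and> a \<le> b \<and> b \<le> 1}"

definition neg :: "ffun \<Rightarrow> ffun" where
  "neg f = (\<lambda>x\<in>II. f (1 - x))"

definition dual :: "(ffun \<times> ffun \<Rightarrow> ffun) \<Rightarrow> (ffun \<times> ffun \<Rightarrow> ffun)" where
  "dual D = (\<lambda>(f, g)\<in>MM \<times> MM. neg (D (neg f, neg g)))"

text \<open>
  For \<open>f, g \<in> MM\<close> and \<open>x \<in> II\<close> the set below is nonempty (take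
  \<open>y = z = x\<close>) and bounded by \<open>1\<close>, so the real supremum is the intended one.
\<close>

definition meetM :: "ffun \<Rightarrow> ffun \<Rightarrow> ffun" where
  "meetM f g = (\<lambda>x\<in>II. Sup {min (f y) (g z) | y z. y \<in> II \<and> z \<in> II \<and> min y z = x})"

definition leM :: "ffun \<Rightarrow> ffun \<Rightarrow> bool" where
  "leM f g \<longleftrightarrow> meetM f g = f"

definition O1 :: "(ffun \<times> ffun \<Rightarrow> ffun) \<Rightarrow> bool" where
  "O1 T \<longleftrightarrow> (\<forall>f\<in>LL. \<forall>g\<in>LL. T (f, g) = T (g, f))"

definition O2 :: "(ffun \<times> ffun \<Rightarrow> ffun) \<Rightarrow> bool" where
  "O2 T \<longleftrightarrow> (\<forall>f\<in>LL. \<forall>g\<in>LL. \<forall>h\<in>LL. T (T (f, g), h) = T (f, T (g, h)))"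

definition O3 :: "(ffun \<times> ffun \<Rightarrow> ffun) \<Rightarrow> bool" where
  "O3 T \<longleftrightarrow> (\<forall>f\<in>LL. T (f, chi {1}) = f)"

definition O3' :: "(ffun \<times> ffun \<Rightarrow> ffun) \<Rightarrow> bool" where
  "O3' T \<longleftrightarrow> (\<forall>f\<in>LL. T (f, chi {0}) = f)"

definition O4 :: "(ffun \<times> ffun \<Rightarrow> ffun) \<Rightarrow> bool" where
  "O4 T \<longleftrightarrow> (\<forall>f\<in>LL. \<forall>g\<in>LL. \<forall>h\<in>LL. leM f g \<longrightarrow> leM (T (f, h)) (T (g, h)))"

definition O5 :: "(ffun \<times> ffun \<Rightarrow> ffun) \<Rightarrow> bool" where
  "O5 T \<longleftrightarrow> (\<forall>a b. 0 \<le> a \<and> a \<le> b \<and> b \<le> 1 \<longrightarrow> T (chi {0..1}, chi {a..b}) = chi {0..b})"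

definition O5' :: "(ffun \<times> ffun \<Rightarrow> ffun) \<Rightarrow> bool" where
  "O5' T \<longleftrightarrow> (\<forall>a b. 0 \<le> a \<and> a \<le> b \<and> b \<le> 1 \<longrightarrow> T (chi {0..1}, chi {a..b}) = chi {a..1})"

definition O6 :: "(ffun \<times> ffun \<Rightarrow> ffun) \<Rightarrow> bool" where
  "O6 T \<longleftrightarrow> T ` (JJ \<times> JJ) \<subseteq> JJ"

definition O7 :: "(ffun \<times> ffun \<Rightarrow> ffun) \<Rightarrow> bool" where
  "O7 T \<longleftrightarrow> T ` (KK \<times> KK) \<subseteq> KK"

definition t_norm :: "(ffun \<times> ffun \<Rightarrow> ffun) \<Rightarrow> bool" where
  "t_norm T \<longleftrightarrow> T \<in> LL \<times> LL \<rightarrow> LL \<and> O1 T \<and> O2 T \<and> O3 T \<and> O4 T"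

definition t_conorm :: "(ffun \<times> ffun \<Rightarrow> ffun) \<Rightarrow> bool" where
  "t_conorm T \<longleftrightarrow> T \<in> LL \<times> LL \<rightarrow> LL \<and> O1 T \<and> O2 T \<and> O3' T \<and> O4 T"

definition tr_norm :: "(ffun \<times> ffun \<Rightarrow> ffun) \<Rightarrow> bool" where
  "tr_norm T \<longleftrightarrow> T \<in> LL \<times> LL \<rightarrow> LL \<and> O1 T \<and> O2 T \<and> O3 T \<and> O4 T \<and> O5 T \<and> O6 T \<and> O7 T"

definition tr_conorm :: "(ffun \<times> ffun \<Rightarrow> ffun) \<Rightarrow> bool" where
  "tr_conorm T \<longleftrightarrow> T \<in> LL \<times> LL \<rightarrow> LL \<and> O1 T \<and> O2 T \<and> O3' T \<and> O4 T \<and> O5' T \<and> O6 T \<and> O7 T"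

end

(* Conjugation by the involution neg carries all axioms of one kind to those of the other
   by bookkeeping, except monotonicity (O4): there neg must be shown to reverse the order
   on normal convex functions. With fR x = sup {f y | y >= x} and fL x = sup {f y | y <= x}, the
   order satisfies: f below g iff f <= gR and g <= fL pointwise. The reflection
   x -> 1 - x exchanges these two conditions. *)

theory Submission
  imports Defs
begin

section \<open>The reflection \<open>neg\<close> on the unit interval and its invariant
  classes\<close>

lemma II_iff [simp]: "x \<in> II \<longleftrightarrow> 0 \<le> x \<and> x \<le> 1"
  by (auto simp: II_def)

lemma LL_imp_MM: "f \<in> LL \<Longrightarrow> f \<in> MM"
  by (simp add: LL_def)

lemma MM_bounds:
  assumes "f \<in> MM" "0 \<le> x" "x \<le> 1"
  shows "0 \<le> f x" "f x \<le> 1"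
proof -
  have "f x \<in> II" using assms PiE_mem[of f II "\<lambda>_. II" x] by (auto simp: MM_def)
  then show "0 \<le> f x" "f x \<le> 1" by auto
qed

lemma MM_eqI:
  assumes "f \<in> MM" "g \<in> MM" "\<And>x. 0 \<le> x \<Longrightarrow> x \<le> 1 \<Longrightarrow> f x = g x"
  shows "f = g"
proof (rule PiE_ext)
  show "f \<in> II \<rightarrow>\<^sub>E II" "g \<in> II \<rightarrow>\<^sub>E II" using assms by (auto simp: MM_def)
qed (use assms in auto)

lemma neg_apply: "0 \<le> x \<Longrightarrow> x \<le> 1 \<Longrightarrow> neg f x = f (1 - x)"
  by (simp add: neg_def)

lemma neg_in_MM: "f \<in> MM \<Longrightarrow> neg f \<in> MM"
  using MM_bounds[of f "1 - x" for x]
  by (auto simp: MM_def neg_def restrict_PiE_iff)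

lemma neg_neg: "f \<in> MM \<Longrightarrow> neg (neg f) = f"
  by (rule MM_eqI) (auto simp: neg_in_MM neg_apply)

lemma is_normal_neg:
  assumes "is_normal f"
  shows "is_normal (neg f)"
proof -
  have "neg f ` II = f ` II"
  proof safe
    fix x assume "x \<in> II"
    then show "neg f x \<in> f ` II" by (auto simp: neg_apply)
    have "f x = neg f (1 - x)" using \<open>x \<in> II\<close> by (simp add: neg_apply)
    then show "f x \<in> neg f ` II" using \<open>x \<in> II\<close> by auto
  qed
  then show ?thesis using assms by (simp add: is_normal_def)
qed

lemma is_convexD:
  "is_convex f \<Longrightarrow> 0 \<le> x \<Longrightarrow> x \<le> y \<Longrightarrow> y \<le> z \<Longrightarrow> z \<le> 1 \<Longrightarrow> min (f x) (f z) \<le> f y"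
  by (auto simp: is_convex_def)

lemma is_convex_neg:
  assumes "is_convex f"
  shows "is_convex (neg f)"
  unfolding is_convex_def
proof safe
  fix x y z :: real assume "0 \<le> x" "x \<le> y" "y \<le> z" "z \<le> 1"
  then show "min (neg f x) (neg f z) \<le> neg f y"
    using is_convexD[OF assms, of "1 - z" "1 - y" "1 - x"]
    by (simp add: neg_apply min.commute)
qed

lemma neg_in_LL: "f \<in> LL \<Longrightarrow> neg f \<in> LL"
  by (simp add: LL_def neg_in_MM is_normal_neg is_convex_neg)

lemma chi_in_MM: "chi B \<in> MM"
  by (auto simp: MM_def chi_def indicator_def)

lemma chi_apply: "0 \<le> x \<Longrightarrow> x \<le> 1 \<Longrightarrow> chi B x = indicator B x"
  by (simp add: chi_def)

lemma chi_interval_in_LL: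
  assumes "0 \<le> a" "a \<le> b" "b \<le> 1"
  shows "chi {a..b} \<in> LL"
proof -
  have "(SUP x\<in>II. chi {a..b} x) = 1"
  proof (rule cSup_eq_maximum)
    have "chi {a..b} a = 1" "a \<in> II" using assms by (auto simp: chi_def)
    then show "1 \<in> chi {a..b} ` II" by (metis imageI)
  qed (auto simp: chi_def indicator_def)
  moreover have "is_convex (chi {a..b})"
    unfolding is_convex_def by (auto simp: chi_def indicator_def)
  ultimately show ?thesis by (simp add: LL_def chi_in_MM is_normal_def)
qed

text \<open>Reflection swaps the roles of the endpoints; this turns the unit \<open>chi {1}\<close>
  into \<open>chi {0}\<close> and \<open>O5\<close> into \<open>O5'\<close>.\<close>

lemma neg_chi_interval: "neg (chi {a..b}) = chi {1 - b..1 - a}"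
  by (rule MM_eqI) (auto simp: neg_in_MM chi_in_MM neg_apply chi_apply indicator_def)

lemma neg_chi_singleton: "neg (chi {a}) = chi {1 - a}"
  using neg_chi_interval[of a a] by simp

lemma KK_subset_LL: "KK \<subseteq> LL"
  by (auto simp: KK_def chi_interval_in_LL)

lemma JJ_subset_LL: "JJ \<subseteq> LL"
  using chi_interval_in_LL[of x x for x] by (auto simp: JJ_def)

lemma neg_in_JJ: "f \<in> JJ \<Longrightarrow> neg f \<in> JJ"
  by (fastforce simp: JJ_def neg_chi_singleton)

lemma neg_in_KK: "f \<in> KK \<Longrightarrow> neg f \<in> KK"
  by (fastforce simp: KK_def neg_chi_interval)

section \<open>The order \<open>leM\<close> through one-sided domination\<close>

lemma is_normal_approx:
  assumes "f \<in> MM" "is_normal f" "c < 1"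
  obtains x where "0 \<le> x" "x \<le> 1" "c < f x"
proof -
  have "bdd_above (f ` II)" using MM_bounds[OF assms(1)] by (auto intro!: bdd_aboveI2)
  moreover have "II \<noteq> {}" by (auto simp: II_def)
  ultimately have "\<exists>x\<in>II. c < f x"
    using assms less_cSUP_iff[of II f c] by (simp add: is_normal_def)
  then show thesis using that by auto
qed

text \<open>These express \<open>f \<le> gR\<close> and \<open>g \<le> fL\<close> without mentioning suprema.\<close>

definition right_dominated :: "ffun \<Rightarrow> ffun \<Rightarrow> bool" where
  "right_dominated f g \<longleftrightarrow> (\<forall>x\<in>II. \<forall>c<f x. \<exists>z\<in>II. x \<le> z \<and> c < g z)"

definition left_dominated :: "ffun \<Rightarrow> ffun \<Rightarrow> bool" where
  "left_dominated g f \<longleftrightarrow> (\<forall>x\<in>II. \<forall>c<g x. \<exists>y\<in>II. y \<le> x \<and> c < f y)"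

text \<open>A witness \<open>z\<close> to the right of \<open>1 - x\<close> reflects to
  \<open>1 - z\<close> on the left of \<open>x\<close>.\<close>

lemma left_dominated_neg:
  assumes "right_dominated f g"
  shows "left_dominated (neg f) (neg g)"
  unfolding left_dominated_def
proof safe
  fix x c assume "x \<in> II" "c < neg f x"
  then have "1 - x \<in> II" "c < f (1 - x)" by (auto simp: neg_apply)
  then obtain z where "z \<in> II" "1 - x \<le> z" "c < g z"
    using assms unfolding right_dominated_def by blast
  then show "\<exists>y\<in>II. y \<le> x \<and> c < neg g y"
    by (intro bexI[of _ "1 - z"]) (auto simp: neg_apply)
qed

lemma right_dominated_neg:
  assumes "left_dominated f g"
  shows "right_dominated (neg f) (neg g)"
  unfolding right_dominated_def
proof safe
  fix x c assume "x \<in> II" "c < neg f x"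
  then have "1 - x \<in> II" "c < f (1 - x)" by (auto simp: neg_apply)
  then obtain z where "z \<in> II" "z \<le> 1 - x" "c < g z"
    using assms unfolding left_dominated_def by blast
  then show "\<exists>y\<in>II. x \<le> y \<and> c < neg g y"
    by (intro bexI[of _ "1 - z"]) (auto simp: neg_apply)
qed

text \<open>Right domination holds since \<open>min y z = x\<close> forces \<open>x \<le> z\<close>,
  so values of \<open>g\<close> right of \<open>x\<close> drive the supremum at \<open>x\<close>.
  Left domination rests on the normality of \<open>f\<close>.\<close>

lemma leM_imp_dominated:
  assumes f: "f \<in> LL" and g: "g \<in> LL" and le: "leM f g"
  shows "right_dominated f g" "left_dominated g f"
proof -
  define S where "S x = {min (f y) (g z) | y z. y \<in> II \<and> z \<in> II \<and> min y z = x}" for x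
  have fx: "f x = Sup (S x)" if "x \<in> II" for x
  proof -
    have "f x = meetM f g x" using le by (simp add: leM_def)
    also have "\<dots> = Sup (S x)" unfolding meetM_def S_def using that by (rule restrict_apply')
    finally show ?thesis .
  qed
  have bdd: "bdd_above (S x)" for x
    using MM_bounds[OF LL_imp_MM[OF f]]
    by (intro bdd_aboveI[of _ 1]) (auto simp: S_def min_le_iff_disj)
  have inS: "min (f y) (g z) \<in> S (min y z)" if "y \<in> II" "z \<in> II" for y z
    using that unfolding S_def by blast
  show "right_dominated f g"
    unfolding right_dominated_def
  proof (intro ballI allI impI)
    fix x c assume x: "x \<in> II" and "c < f x"
    moreover have "S x \<noteq> {}" using inS[OF x x] by auto
    ultimately obtain s where "s \<in> S x" "c < s"
      using fx[OF x] bdd less_cSup_iff by metis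
    then obtain y z where "z \<in> II" "min y z = x" "c < min (f y) (g z)"
      unfolding S_def by blast
    then show "\<exists>z\<in>II. x \<le> z \<and> c < g z" by (intro bexI[of _ z]) auto
  qed
  show "left_dominated g f"
    unfolding left_dominated_def
  proof (intro ballI allI impI, rule ccontr)
    fix x c assume x: "x \<in> II" and c: "c < g x"
      and no: "\<not> (\<exists>y\<in>II. y \<le> x \<and> c < f y)"
    \<comment> \<open>The supremum 1 of \<open>f\<close> need not be attained, so a level strictly
      below 1 is needed to find a point where \<open>f\<close> exceeds \<open>c\<close>.\<close>
    have "c < 1" using c x MM_bounds(2)[OF LL_imp_MM[OF g], of x] by simp
    then obtain y where y: "0 \<le> y" "y \<le> 1" "c < f y"
      using f is_normal_approx[of f c] by (auto simp: LL_def)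
    then have "x < y" using no y by (metis II_iff not_le)
    \<comment> \<open>As \<open>y\<close> lies right of \<open>x\<close>, the pair
      \<open>(y, x)\<close> competes in the supremum at \<open>x\<close> and pushes
      \<open>f x\<close> above \<open>c\<close>.\<close>
    then have "min (f y) (g x) \<in> S x" using inS[of y x] x y by (simp add: min_def)
    then have "min (f y) (g x) \<le> f x" unfolding fx[OF x] by (rule cSup_upper[OF _ bdd])
    then have "c < f x" using y c by linarith
    then show False using no x by auto
  qed
qed

text \<open>Left domination and convexity keep the meet below \<open>f\<close>; right domination
  makes it reach \<open>f\<close>.\<close>

lemma dominated_imp_leM:
  assumes f: "f \<in> LL" and r: "right_dominated f g" and l: "left_dominated g f"
  shows "leM f g"
proof -
  have "meetM f g x = f x" for x
  proof (cases "x \<in> II")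
    case False
    \<comment> \<open>Outside \<open>II\<close> both sides are \<open>undefined\<close>.\<close>
    then show ?thesis
      using PiE_arb[of f II "\<lambda>_. II" x] LL_imp_MM[OF f]
      unfolding meetM_def MM_def restrict_def by (simp del: II_iff)
  next
    case x: True
    let ?S = "{min (f y) (g z) | y z. y \<in> II \<and> z \<in> II \<and> min y z = x}"
    have upper: "s \<le> f x" if "s \<in> ?S" for s
    proof -
      from that obtain y z where s: "s = min (f y) (g z)"
        and yz: "y \<in> II" "z \<in> II" "min y z = x" by auto
      show ?thesis
      proof (cases "y \<le> z")
        case True
        then show ?thesis using s yz by auto
      next
        case False
        then have z: "z = x" and "x \<le> y" using yz by auto
        show ?thesis
        proof (rule ccontr)
          assume "\<not> s \<le> f x"
          then have *: "f x < f y" "f x < g x" using s z by auto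
          \<comment> \<open>Now \<open>f\<close> exceeds \<open>f x\<close> both at
            \<open>y'\<close> on the left and at \<open>y\<close> on the right, contradicting
            convexity.\<close>
          then obtain y' where "y' \<in> II" "y' \<le> x" "f x < f y'"
            using l x unfolding left_dominated_def by blast
          then show False
            using is_convexD[of f y' x y] f yz \<open>x \<le> y\<close> * by (auto simp: LL_def)
        qed
      qed
    qed
    have inS: "min (f x) (g z) \<in> ?S" if "z \<in> II" "x \<le> z" for z
    proof -
      have "min x z = x" using that by simp
      then show ?thesis using x that by blast
    qed
    have ne: "?S \<noteq> {}" using inS[OF x] by blast
    have "Sup ?S = f x"
    proof (rule cSup_eq_non_empty[OF ne upper])
      fix u assume u: "\<And>s. s \<in> ?S \<Longrightarrow> s \<le> u"
      show "f x \<le> u"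
      proof (rule ccontr)
        assume "\<not> f x \<le> u"
        then obtain z where "z \<in> II" "x \<le> z" "u < g z"
          using r x unfolding right_dominated_def by (meson not_le)
        \<comment> \<open>Both \<open>f x\<close> and \<open>g z\<close> exceed \<open>u\<close>,
          hence so does their minimum, a member of the set.\<close>
        then show False using u[OF inS, of z] \<open>\<not> f x \<le> u\<close> by linarith
      qed
    qed
    then show ?thesis using x unfolding meetM_def by (simp del: II_iff)
  qed
  then show ?thesis by (auto simp: leM_def)
qed

text \<open>Each domination condition for \<open>f\<close>, \<open>g\<close> reflects into the other
  one for \<open>neg g\<close>, \<open>neg f\<close>.\<close>

lemma leM_neg:
  assumes "f \<in> LL" "g \<in> LL" "leM f g"
  shows "leM (neg g) (neg f)"
  using leM_imp_dominated[OF assms] assms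
  by (intro dominated_imp_leM left_dominated_neg right_dominated_neg neg_in_LL)

section \<open>Transfer of the axioms along conjugation by \<open>neg\<close>\<close>

locale neg_conjugate =
  fixes T T' :: "ffun \<times> ffun \<Rightarrow> ffun"
  assumes closed: "f \<in> LL \<Longrightarrow> g \<in> LL \<Longrightarrow> T (f, g) \<in> LL"
    and conj: "f \<in> LL \<Longrightarrow> g \<in> LL \<Longrightarrow> T' (f, g) = neg (T (neg f, neg g))"
begin

lemma closed': "f \<in> LL \<Longrightarrow> g \<in> LL \<Longrightarrow> T' (f, g) \<in> LL"
  by (simp add: conj closed neg_in_LL)

lemma neg_T': "f \<in> LL \<Longrightarrow> g \<in> LL \<Longrightarrow> neg (T' (f, g)) = T (neg f, neg g)"
  by (simp add: conj neg_neg LL_imp_MM closed neg_in_LL)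

text \<open>Since \<open>neg\<close> is an involution, conjugating twice returns \<open>T\<close>;
  exchanging the two operations thus yields every converse.\<close>

lemma sym: "neg_conjugate T' T"
  by unfold_locales (simp_all add: closed' neg_T' neg_in_LL neg_neg LL_imp_MM)

lemma O1: "O1 T \<Longrightarrow> O1 T'"
  by (simp add: O1_def conj neg_in_LL)

lemma O2: "O2 T \<Longrightarrow> O2 T'"
  \<comment> \<open>These instances of \<open>conj\<close> unfold only the outer application, so
    that \<open>neg_T'\<close> can absorb the inner one.\<close>
  unfolding O2_def by (simp add: conj[OF closed'] conj[OF _ closed'] neg_T' neg_in_LL)

lemma O3: "O3 T \<Longrightarrow> O3' T'"
  using chi_interval_in_LL[of 0 0]
  by (simp add: O3_def O3'_def conj neg_chi_singleton neg_in_LL neg_neg LL_imp_MM)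

lemma O3': "O3' T \<Longrightarrow> O3 T'"
  using chi_interval_in_LL[of 1 1]
  by (simp add: O3_def O3'_def conj neg_chi_singleton neg_in_LL neg_neg LL_imp_MM)

text \<open>The order is reversed twice, once on the arguments and once on the values.\<close>

lemma O4:
  assumes "O4 T"
  shows "O4 T'"
  unfolding O4_def
proof (intro ballI impI)
  fix f g h assume L: "f \<in> LL" "g \<in> LL" "h \<in> LL" and "leM f g"
  then have "leM (neg g) (neg f)" by (simp add: leM_neg)
  then have "leM (T (neg g, neg h)) (T (neg f, neg h))"
    using assms L by (simp add: O4_def neg_in_LL)
  then show "leM (T' (f, h)) (T' (g, h))"
    using L by (simp add: conj leM_neg closed neg_in_LL)
qed

text \<open>\<open>chi {0..1}\<close> is fixed by \<open>neg\<close>; \<open>T\<close> sends the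
  reflected interval to \<open>chi {0..1 - a}\<close>, which reflects to
  \<open>chi {a..1}\<close>.\<close>

lemma O5: "O5 T \<Longrightarrow> O5' T'"
  by (simp add: O5_def O5'_def conj chi_interval_in_LL neg_chi_interval)

lemma O5': "O5' T \<Longrightarrow> O5 T'"
  by (simp add: O5_def O5'_def conj chi_interval_in_LL neg_chi_interval)

lemma image_subset_conj:
  assumes "A \<subseteq> LL" "\<And>f. f \<in> A \<Longrightarrow> neg f \<in> A" "T ` (A \<times> A) \<subseteq> A"
  shows "T' ` (A \<times> A) \<subseteq> A"
proof clarify
  fix f g assume "f \<in> A" "g \<in> A"
  moreover from this have "T (neg f, neg g) \<in> A"
    using assms(2,3) by (simp add: image_subset_iff)
  ultimately show "T' (f, g) \<in> A" using assms(1,2) by (simp add: conj subset_iff)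
qed

lemma O6: "O6 T \<Longrightarrow> O6 T'"
  unfolding O6_def by (rule image_subset_conj[OF JJ_subset_LL neg_in_JJ])

lemma O7: "O7 T \<Longrightarrow> O7 T'"
  unfolding O7_def by (rule image_subset_conj[OF KK_subset_LL neg_in_KK])

lemma t_norm_imp_t_conorm: "t_norm T \<Longrightarrow> t_conorm T'"
  by (auto simp: t_norm_def t_conorm_def closed' O1 O2 O3 O4)

lemma t_conorm_imp_t_norm: "t_conorm T \<Longrightarrow> t_norm T'"
  by (auto simp: t_norm_def t_conorm_def closed' O1 O2 O3' O4)

lemma tr_norm_imp_tr_conorm: "tr_norm T \<Longrightarrow> tr_conorm T'"
  by (auto simp: tr_norm_def tr_conorm_def closed' O1 O2 O3 O4 O5 O6 O7)

lemma tr_conorm_imp_tr_norm: "tr_conorm T \<Longrightarrow> tr_norm T'"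
  by (auto simp: tr_norm_def tr_conorm_def closed' O1 O2 O3' O4 O5' O6 O7)

end

theorem theorem6p1:
  fixes D :: "ffun \<times> ffun \<Rightarrow> ffun"
  assumes "D \<in> MM \<times> MM \<rightarrow> MM"
    and "D ` (LL \<times> LL) \<subseteq> LL"
  shows "(tr_norm (restrict D (LL \<times> LL)) \<longleftrightarrow> tr_conorm (restrict (dual D) (LL \<times> LL))) \<and>
         (t_norm (restrict D (LL \<times> LL)) \<longleftrightarrow> t_conorm (restrict (dual D) (LL \<times> LL)))"
proof -
  interpret D: neg_conjugate "restrict D (LL \<times> LL)" "restrict (dual D) (LL \<times> LL)"
  proof
    fix f g assume fg: "f \<in> LL" "g \<in> LL"
    then show "restrict D (LL \<times> LL) (f, g) \<in> LL"
      using assms(2) by (simp add: image_subset_iff)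
    \<comment> \<open>\<open>neg\<close> keeps the arguments in \<open>LL\<close>, so every
      restriction here is evaluated inside its domain.\<close>
    show "restrict (dual D) (LL \<times> LL) (f, g) =
        neg (restrict D (LL \<times> LL) (neg f, neg g))"
      using fg by (simp add: dual_def LL_imp_MM neg_in_LL)
  qed
  \<comment> \<open>The exchanged interpretation supplies the right-to-left implications.\<close>
  interpret D': neg_conjugate "restrict (dual D) (LL \<times> LL)" "restrict D (LL \<times> LL)"
    by (rule D.sym)
  show ?thesis
    using D.tr_norm_imp_tr_conorm D'.tr_conorm_imp_tr_norm
      D.t_norm_imp_t_conorm D'.t_conorm_imp_t_norm by (intro conjI iffI)
qed

end
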